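(* Let $0<p<1$ and let $A=\operatorname{diag}(J_1,\dots,J_l)$, where $J_j$ is the $n_j\times n_j$ upper triangular Jordan block with eigenvalue $\lambda_j\ne0$, with $|\arg\lambda_j|>p\pi/2$ for $j=1,\dots,s$ and $|\arg\lambda_j|<p\pi/2$ for $j=s+1,\dots,l$. Let $B(\cdot)$ and $\widetilde{B}(\cdot)$ be the block diagonal matrix functions associated with $A$ defined in the context. Then for any $t,\tau>0$, $$(t-\tau)\,B(t)\,\widetilde{B}(-\tau)=\frac{-\tau}{p}\,\widetilde{B}(t-\tau).$$
   Context: Arguments are taken in $(-\pi,\pi]$ and $\lambda^{1/p}$ denotes the principal branch. For $t\in\mathbb R$, $B(t)=\operatorname{diag}(B_1(t),\dots,B_l(t))$ and $\widetilde{B}(t)=\operatorname{diag}(\widetilde{B_1}(t),\dots,\widetilde{B_l}(t))$ with $n_j\times n_j$ blocks. For $j=1,\dots,s$, $B_j(t)=\widetilde{B_j}(t)=0$. For $j=s+1,\dots,l$, $B_j(t)$ and $\widetilde{B_j}(t)$ are the upper triangular Toeplitz matrices with first rows $(\Psi_0(t,\lambda_j),\dots,\Psi_{n_j-1}(t,\lambda_j))$ and $(\widetilde{\Psi}_0(t,\lambda_j),\dots,\widetilde{\Psi}_{n_j-1}(t,\lambda_j))$ respectively, where $$\Psi_m(t,\lambda_j)=\frac1{m!}\left.\frac{\partial^m}{\partial\lambda^m}\left(\frac1p\exp(t\lambda^{1/p})\right)\right|_{\lambda=\lambda_j},\qquad \widetilde{\Psi}_m(t,\lambda_j)=\frac1{m!}\left.\frac{\partial^{m+1}}{\partial\lambda^{m+1}}\exp(t\lambda^{1/p})\right|_{\lambda=\lambda_j}.$$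 An upper triangular Toeplitz matrix with first row $(a_0,\dots,a_{n-1})$ has $(i,k)$ entry $a_{k-i}$ for $k\ge i$ and $0$ otherwise. *)

theory Defs
  imports
    "HOL-Analysis.Complex_Transcendental"
    "Jordan_Normal_Form.Jordan_Normal_Form"
begin

text \<open>
  The complex \<open>powr\<close> is the principal branch: \<open>z powr w = exp (w * Ln z)\<close> for \<open>z \<noteq> 0\<close>,
  with the imaginary part of \<open>Ln z\<close>, that is \<open>Arg z\<close>, in \<open>(-pi, pi]\<close>. The derivatives in
  \<open>z\<close> are complex derivatives.
\<close>

definition Psi :: "real \<Rightarrow> nat \<Rightarrow> real \<Rightarrow> complex \<Rightarrow> complex" where
  "Psi p m t a = 1 / fact m *
     (deriv ^^ m) (\<lambda>z. 1 / of_real p * exp (of_real t * z powr of_real (1 / p))) a"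

definition Psi_tilde :: "real \<Rightarrow> nat \<Rightarrow> real \<Rightarrow> complex \<Rightarrow> complex" where
  "Psi_tilde p m t a = 1 / fact m *
     (deriv ^^ (m + 1)) (\<lambda>z. exp (of_real t * z powr of_real (1 / p))) a"

definition upper_toeplitz :: "nat \<Rightarrow> (nat \<Rightarrow> complex) \<Rightarrow> complex mat" where
  "upper_toeplitz n a = Matrix.mat n n (\<lambda>(i, k). if i \<le> k then a (k - i) else 0)"

text \<open>
  Blocks are numbered \<open>1, \<dots>, l\<close>; block \<open>j\<close> has size \<open>n j\<close> and eigenvalue \<open>ev j\<close>.
  Only the values of \<open>n\<close> and \<open>ev\<close> on \<open>{1..l}\<close> matter.
\<close>

definition B_mat ::
  "real \<Rightarrow> nat \<Rightarrow> nat \<Rightarrow> (nat \<Rightarrow> nat) \<Rightarrow> (nat \<Rightarrow> complex) \<Rightarrow> real \<Rightarrow> complex mat" where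
  "B_mat p l s n ev t = diag_block_mat
     (map (\<lambda>j. if j \<le> s then 0\<^sub>m (n j) (n j)
               else upper_toeplitz (n j) (\<lambda>m. Psi p m t (ev j))) [1..<Suc l])"

definition B_tilde_mat ::
  "real \<Rightarrow> nat \<Rightarrow> nat \<Rightarrow> (nat \<Rightarrow> nat) \<Rightarrow> (nat \<Rightarrow> complex) \<Rightarrow> real \<Rightarrow> complex mat" where
  "B_tilde_mat p l s n ev t = diag_block_mat
     (map (\<lambda>j. if j \<le> s then 0\<^sub>m (n j) (n j)
               else upper_toeplitz (n j) (\<lambda>m. Psi_tilde p m t (ev j))) [1..<Suc l])"

end

theory Submission
  imports Defs "HOL-Complex_Analysis.Cauchy_Integral_Formula"
begin

text \<open>
  The matrix identity is the Taylor expansion of one scalar identity. Write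
  \<open>F\<^sub>c(z) = exp (c g(z))\<close> with \<open>g(z) = z powr (1/p)\<close>. Off the branch cut
  \<open>F\<^sub>c' = c g' F\<^sub>c\<close> and \<open>F\<^sub>b F\<^sub>c = F\<^sub>b\<^sub>+\<^sub>c\<close>, so \<open>F\<^sub>b F\<^sub>c' = c g' F\<^sub>b\<^sub>+\<^sub>c\<close>
  and hence \<open>(b + c) F\<^sub>b F\<^sub>c' = c F\<^sub>b\<^sub>+\<^sub>c'\<close>; the claim is the case \<open>b = t\<close>,
  \<open>c = - \<tau>\<close>, divided by \<open>p\<close>. Now \<open>Psi\<close> and \<open>Psi_tilde\<close> are the Taylor
  coefficients of \<open>F\<^sub>b / p\<close> and of \<open>F\<^sub>c'\<close> at the eigenvalue. Multiplying upper
  triangular Toeplitz matrices convolves their first rows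
  (\<open>upper_toeplitz_mult\<close>), multiplying functions convolves their Taylor
  coefficients (\<open>taylor_coeff_mult\<close>), and so the scalar identity passes to each
  block, and from there to block diagonal matrices. In the blocks up to \<open>s\<close> both sides
  vanish. In the others, \<open>\<bar>Arg \<lambda>\<bar> < p\<pi>/2 < \<pi>\<close> keeps the nonzero eigenvalue off the branch cut,
  where all functions involved are holomorphic.
\<close>

lemma diag_block_mat_mult:
  fixes A B :: "'i \<Rightarrow> 'a :: comm_semiring_0 mat"
  assumes "\<And>j. j \<in> set js \<Longrightarrow> A j \<in> carrier_mat (n j) (n j)"
    and "\<And>j. j \<in> set js \<Longrightarrow> B j \<in> carrier_mat (n j) (n j)"
  shows "diag_block_mat (map A js) * diag_block_mat (map B js)
    = diag_block_mat (map (\<lambda>j. A j * B j) js)"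
  using assms
proof (induction js)
  case Nil
  then show ?case by simp
next
  case (Cons j js)
  let ?N = "sum_list (map n js)"
  have dims: "map dim_row (map A js) = map n js" "map dim_col (map A js) = map n js"
    "map dim_row (map B js) = map n js" "map dim_col (map B js) = map n js"
    "map dim_row (map (\<lambda>j. A j * B j) js) = map n js"
    "map dim_col (map (\<lambda>j. A j * B j) js) = map n js"
    using Cons.prems by force+
  have carr: "diag_block_mat (map A js) \<in> carrier_mat ?N ?N"
    "diag_block_mat (map B js) \<in> carrier_mat ?N ?N"
    "diag_block_mat (map (\<lambda>j. A j * B j) js) \<in> carrier_mat ?N ?N"
    by (intro carrier_matI; simp only: dim_diag_block_mat dims)+
  have hd: "A j \<in> carrier_mat (n j) (n j)" "B j \<in> carrier_mat (n j) (n j)"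
    using Cons.prems by auto
  have IH: "diag_block_mat (map A js) * diag_block_mat (map B js)
      = diag_block_mat (map (\<lambda>j. A j * B j) js)"
    using Cons by simp
  have "diag_block_mat (map A (j # js)) * diag_block_mat (map B (j # js))
    = four_block_mat (A j) (0\<^sub>m (n j) ?N) (0\<^sub>m ?N (n j)) (diag_block_mat (map A js))
      * four_block_mat (B j) (0\<^sub>m (n j) ?N) (0\<^sub>m ?N (n j)) (diag_block_mat (map B js))"
    using carr hd by (simp add: Let_def)
  also have "\<dots> = four_block_mat (A j * B j) (0\<^sub>m (n j) ?N) (0\<^sub>m ?N (n j))
      (diag_block_mat (map (\<lambda>j. A j * B j) js))"
    using carr hd
    by (subst mult_four_block_mat[where ?nr1.0 = "n j" and ?n1.0 = "n j" and ?n2.0 = ?N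
          and ?nr2.0 = ?N and ?nc1.0 = "n j" and ?nc2.0 = ?N])
      (simp_all add: IH)
  also have "\<dots> = diag_block_mat (map (\<lambda>j. A j * B j) (j # js))"
    using carr hd by (simp add: Let_def)
  finally show ?case .
qed

lemma smult_diag_block_mat:
  fixes c :: "'a :: semiring_0"
  shows "c \<cdot>\<^sub>m diag_block_mat As = diag_block_mat (map (\<lambda>A. c \<cdot>\<^sub>m A) As)"
proof (induction As)
  case Nil
  then show ?case by (intro eq_matI) auto
next
  case (Cons A As)
  have dims: "dim_row (diag_block_mat (map (\<lambda>A. c \<cdot>\<^sub>m A) As)) = dim_row (diag_block_mat As)"
    "dim_col (diag_block_mat (map (\<lambda>A. c \<cdot>\<^sub>m A) As)) = dim_col (diag_block_mat As)"
    by (simp_all flip: Cons.IH)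
  show ?case
    by (intro eq_matI) (auto simp: Let_def dims simp flip: Cons.IH)
qed

lemma upper_toeplitz_carrier [simp]: "upper_toeplitz n a \<in> carrier_mat n n"
  by (simp add: upper_toeplitz_def)

text \<open>
  Entry \<open>(i, k)\<close> of the product sums \<open>a (r - i) * b (k - r)\<close> over \<open>r\<close> between \<open>i\<close> and
  \<open>k\<close>; shifting \<open>r\<close> by \<open>i\<close> gives a convolution that depends on \<open>k - i\<close> only.
\<close>

lemma upper_toeplitz_mult:
  "upper_toeplitz n a * upper_toeplitz n b
    = upper_toeplitz n (\<lambda>m. \<Sum>i=0..m. a i * b (m - i))"
proof (intro eq_matI)
  fix i k
  assume "i < dim_row (upper_toeplitz n (\<lambda>m. \<Sum>i=0..m. a i * b (m - i)))"
    and "k < dim_col (upper_toeplitz n (\<lambda>m. \<Sum>i=0..m. a i * b (m - i)))"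
  then have ik: "i < n" "k < n"
    by (auto simp: upper_toeplitz_def)
  have "(upper_toeplitz n a * upper_toeplitz n b) $$ (i, k)
      = (\<Sum>r=0..<n. (if i \<le> r then a (r - i) else 0) * (if r \<le> k then b (k - r) else 0))"
    using ik by (simp add: upper_toeplitz_def scalar_prod_def)
  also have "\<dots> = (\<Sum>r=i..k. a (r - i) * b (k - r))"
    using ik by (intro sum.mono_neutral_cong_right) auto
  also have "\<dots> = (if i \<le> k then \<Sum>r=0..k-i. a r * b (k - i - r) else 0)"
  proof (cases "i \<le> k")
    case True
    then have "(\<Sum>r=i..k. a (r - i) * b (k - r)) = (\<Sum>r=0..k-i. a r * b (k - i - r))"
      by (intro sum.reindex_bij_witness[where i = "\<lambda>r. r + i" and j = "\<lambda>r. r - i"]) auto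
    then show ?thesis
      using True by simp
  qed simp
  also have "\<dots> = upper_toeplitz n (\<lambda>m. \<Sum>i=0..m. a i * b (m - i)) $$ (i, k)"
    using ik by (simp add: upper_toeplitz_def)
  finally show "(upper_toeplitz n a * upper_toeplitz n b) $$ (i, k)
      = upper_toeplitz n (\<lambda>m. \<Sum>i=0..m. a i * b (m - i)) $$ (i, k)" .
qed (simp_all add: upper_toeplitz_def)

lemma smult_upper_toeplitz:
  "c \<cdot>\<^sub>m upper_toeplitz n a = upper_toeplitz n (\<lambda>m. c * a m)"
  by (intro eq_matI) (auto simp: upper_toeplitz_def)

text \<open>
  This is the Leibniz rule, whose binomial coefficients are absorbed by the factorials.
\<close>

lemma taylor_coeff_mult:
  fixes z :: complex
  assumes "f holomorphic_on S" "g holomorphic_on S" "open S" "z \<in> S"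
  shows "(\<Sum>i=0..m. (1 / fact i * (deriv ^^ i) f z) * (1 / fact (m - i) * (deriv ^^ (m - i)) g z))
    = 1 / fact m * (deriv ^^ m) (\<lambda>w. f w * g w) z"
  unfolding higher_deriv_mult[OF assms] sum_distrib_left
  by (intro sum.cong) (auto simp: binomial_fact field_simps)

lemma deriv_exp_cmult:
  fixes g :: "complex \<Rightarrow> complex"
  assumes "g holomorphic_on S" "open S" "z \<in> S"
  shows "deriv (\<lambda>w. exp (c * g w)) z = c * deriv g z * exp (c * g z)"
  using assms
  by (intro DERIV_imp_deriv) (auto intro!: derivative_eq_intros holomorphic_derivI)

lemma exp_mult_deriv_exp:
  fixes g :: "complex \<Rightarrow> complex"
  assumes "g holomorphic_on S" "open S" "z \<in> S"
  shows "(b + c) * (exp (b * g z) * deriv (\<lambda>w. exp (c * g w)) z)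
    = c * deriv (\<lambda>w. exp ((b + c) * g w)) z"
  unfolding deriv_exp_cmult[OF assms] by (simp add: exp_add algebra_simps)

text \<open>
  The scalar identity, read off in the Taylor coefficients. The complement of the branch cut is
  open, so an identity of functions there may be differentiated any number of times at \<open>a\<close>.
\<close>

lemma Psi_conv_Psi_tilde:
  assumes "a \<notin> \<real>\<^sub>\<le>\<^sub>0"
  shows "of_real (b + c) * (\<Sum>i=0..m. Psi p i b a * Psi_tilde p (m - i) c a)
    = of_real (c / p) * Psi_tilde p m (b + c) a"
proof -
  define S :: "complex set" where "S = - \<real>\<^sub>\<le>\<^sub>0"
  define g where "g = (\<lambda>z :: complex. z powr of_real (1 / p))"
  define F where "F = (\<lambda>(c :: real) z. exp (of_real c * g z))"
  have S: "open S" "a \<in> S"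
    using assms by (auto simp: S_def)
  have g: "g holomorphic_on S"
    unfolding g_def S_def by (intro holomorphic_intros) auto
  have F: "F d holomorphic_on S" for d
    unfolding F_def by (intro holomorphic_intros g)
  have F': "deriv (F d) holomorphic_on S" for d
    using F S by (intro holomorphic_deriv)
  have Fp: "(\<lambda>z. 1 / of_real p * F d z) holomorphic_on S" for d
    by (intro holomorphic_intros F)
  let ?h = "\<lambda>z. 1 / of_real p * F b z * deriv (F c) z"
  have h: "?h holomorphic_on S"
    by (intro holomorphic_intros F F')
  have Psi_eq: "Psi p i b a = 1 / fact i * (deriv ^^ i) (\<lambda>z. 1 / of_real p * F b z) a" for i
    by (simp add: Psi_def F_def g_def)
  have tilde_eq: "Psi_tilde p i d a = 1 / fact i * (deriv ^^ i) (deriv (F d)) a" for i d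
    by (simp add: Psi_tilde_def F_def g_def funpow_swap1 del: of_real_divide)
  have "of_real (b + c) * (\<Sum>i=0..m. Psi p i b a * Psi_tilde p (m - i) c a)
      = 1 / fact m * (of_real (b + c) * (deriv ^^ m) ?h a)"
    unfolding Psi_eq tilde_eq taylor_coeff_mult[OF Fp F' S] by simp
  also have "of_real (b + c) * (deriv ^^ m) ?h a = (deriv ^^ m) (\<lambda>z. of_real (b + c) * ?h z) a"
    by (rule higher_deriv_cmult[OF h S(2,1), symmetric])
  also have "\<dots> = (deriv ^^ m) (\<lambda>z. of_real (c / p) * deriv (F (b + c)) z) a"
  proof (rule higher_deriv_transform_within_open[OF _ _ S])
    fix w
    assume "w \<in> S"
    from exp_mult_deriv_exp[OF g S(1) this, of "of_real b" "of_real c"]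
    show "of_real (b + c) * ?h w = of_real (c / p) * deriv (F (b + c)) w"
      \<comment> \<open>For \<open>p = 0\<close> both prefactors \<open>1 / p\<close> and \<open>c / p\<close> are \<open>0\<close> by convention.\<close>
      by (cases "p = 0") (simp_all add: F_def field_simps)
  qed (intro holomorphic_intros h F')+
  also have "\<dots> = of_real (c / p) * (deriv ^^ m) (deriv (F (b + c))) a"
    by (rule higher_deriv_cmult[OF F' S(2,1)])
  finally show ?thesis
    by (simp add: tilde_eq)
qed

theorem lemma6:
  fixes p :: real and l s :: nat and n :: "nat \<Rightarrow> nat" and ev :: "nat \<Rightarrow> complex"
    and A :: "complex mat" and t \<tau> :: real
  assumes "0 < p" and "p < 1"
    and "1 \<le> l" and "s \<le> l"
    and "\<forall>j\<in>{1..l}. 1 \<le> n j"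
    and "A = jordan_matrix (map (\<lambda>j. (n j, ev j)) [1..<Suc l])"
    and "\<forall>j\<in>{1..l}. ev j \<noteq> 0"
    and "\<forall>j\<in>{1..s}. \<bar>Arg (ev j)\<bar> > p * pi / 2"
    and "\<forall>j\<in>{s+1..l}. \<bar>Arg (ev j)\<bar> < p * pi / 2"
    and "t > 0" and "\<tau> > 0"
  shows "complex_of_real (t - \<tau>) \<cdot>\<^sub>m (B_mat p l s n ev t * B_tilde_mat p l s n ev (- \<tau>))
       = complex_of_real (- \<tau> / p) \<cdot>\<^sub>m B_tilde_mat p l s n ev (t - \<tau>)"
proof -
  have off_cut: "ev j \<notin> \<real>\<^sub>\<le>\<^sub>0" if "s < j" "j \<le> l" for j
  proof
    assume "ev j \<in> \<real>\<^sub>\<le>\<^sub>0"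
    moreover have "ev j \<noteq> 0"
      using assms(7) that by auto
    ultimately have "Arg (ev j) = pi"
      by (auto simp: Arg_eq_pi complex_nonpos_Reals_iff complex_eq_iff less_le)
    moreover have "p * pi < 1 * pi"
      using \<open>p < 1\<close> by (intro mult_strict_right_mono) auto
    moreover have "\<bar>Arg (ev j)\<bar> < p * pi / 2"
      using assms(9) that by auto
    ultimately show False
      using pi_gt_zero by linarith
  qed
  let ?B = "\<lambda>j. if j \<le> s then 0\<^sub>m (n j) (n j) else upper_toeplitz (n j) (\<lambda>m. Psi p m t (ev j))"
  let ?T = "\<lambda>u j. if j \<le> s then 0\<^sub>m (n j) (n j)
    else upper_toeplitz (n j) (\<lambda>m. Psi_tilde p m u (ev j))"
  have block: "complex_of_real (t - \<tau>) \<cdot>\<^sub>m (?B j * ?T (- \<tau>) j)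
      = complex_of_real (- \<tau> / p) \<cdot>\<^sub>m ?T (t - \<tau>) j"
    if "j \<in> set [1..<Suc l]" for j
  proof (cases "j \<le> s")
    case True
    then show ?thesis by simp
  next
    case False
    with that have "ev j \<notin> \<real>\<^sub>\<le>\<^sub>0"
      by (intro off_cut) auto
    from Psi_conv_Psi_tilde[OF this, where b = t and c = "- \<tau>" and p = p] False show ?thesis
      by (simp add: upper_toeplitz_mult smult_upper_toeplitz)
  qed
  have "B_mat p l s n ev t * B_tilde_mat p l s n ev (- \<tau>)
      = diag_block_mat (map (\<lambda>j. ?B j * ?T (- \<tau>) j) [1..<Suc l])"
    unfolding B_mat_def B_tilde_mat_def by (rule diag_block_mat_mult) auto
  moreover have "map (\<lambda>j. complex_of_real (t - \<tau>) \<cdot>\<^sub>m (?B j * ?T (- \<tau>) j)) [1..<Suc l]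
      = map (\<lambda>j. complex_of_real (- \<tau> / p) \<cdot>\<^sub>m ?T (t - \<tau>) j) [1..<Suc l]"
    by (intro map_cong refl block)
  ultimately show ?thesis
    unfolding B_tilde_mat_def by (simp only: smult_diag_block_mat map_map o_def)
qed

end
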